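(* Let $C\subset\mathbb{R}^{n+1}$ be a convex body. Given $r_0>0$, there exist positive constants $M$, $\ell_1$, only depending on $r_0$ and $C$, and a universal positive constant $\ell_2$ (depending only on the dimension) such that $$I_{\overline{B}_C(x,r)}(v)\ge M\,\min\{v,|\overline{B}_C(x,r)|-v\}^{n/(n+1)}$$ for all $x\in C$, $0<r\le r_0$, and $0<v<|\overline{B}_C(x,r)|$. Moreover, $$\ell_1 r^{n+1}\le |\overline{B}_C(x,r)|\le \ell_2 r^{n+1}$$ for any $x\in C$, $0<r\le r_0$.
   Context: Here $n\ge 1$. A convex body in $\mathbb{R}^{n+1}$ is a compact convex set with non-empty interior. $|E|$ denotes $(n+1)$-dimensional Lebesgue measure. $\overline{B}(x,r)$ is the closed Euclidean ball and $\overline{B}_C(x,r)=\overline{B}(x,r)\cap C$ (itself a convex body for $x\in C$, $r>0$). For a convex body $K$ and measurable $E\subset K$, the relative perimeter is $P_K(E)=\sup\{\int_E \mathrm{div}\,\xi : \xi \text{ smooth vector field with compact support in } \mathrm{int}(K),\ |\xi|\le 1\}$, and the isoperimetric profile is $I_K(v)=\inf\{P_K(E): E\subset K,\ |E|=v\}$. *)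

theory Defs
  imports "HOL-Analysis.Analysis"
begin

definition convex_body :: "'a::euclidean_space set \<Rightarrow> bool" where
  "convex_body K \<longleftrightarrow> compact K \<and> convex K \<and> interior K \<noteq> {}"

definition rel_cball :: "'a::euclidean_space set \<Rightarrow> 'a \<Rightarrow> real \<Rightarrow> 'a set" where
  "rel_cball C x r = cball x r \<inter> C"

abbreviation vol :: "'a::euclidean_space set \<Rightarrow> real" where
  "vol E \<equiv> measure lebesgue E"

text \<open>In finite dimension, continuity of the derivative is equivalent to continuity of all
  directional derivatives, so this recursion on directional derivatives gives the class of
  \<open>k\<close> times continuously differentiable maps on the whole space.\<close>

primrec Ck :: "nat \<Rightarrow> ('a::euclidean_space \<Rightarrow> 'b::real_normed_vector) \<Rightarrow> bool" where
  "Ck 0 f \<longleftrightarrow> continuous_on UNIV f"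
| "Ck (Suc k) f \<longleftrightarrow>
     (\<forall>x. f differentiable (at x)) \<and> (\<forall>h. Ck k (\<lambda>x. frechet_derivative f (at x) h))"

definition smooth :: "('a::euclidean_space \<Rightarrow> 'b::real_normed_vector) \<Rightarrow> bool" where
  "smooth f \<longleftrightarrow> (\<forall>k. Ck k f)"

definition divergence :: "('a::euclidean_space \<Rightarrow> 'a) \<Rightarrow> 'a \<Rightarrow> real" where
  "divergence \<xi> x = (\<Sum>b\<in>Basis. frechet_derivative \<xi> (at x) b \<bullet> b)"

text \<open>The fields are defined on the whole space; a smooth field on the interior of \<open>K\<close> whose
  support is compact in that interior extends smoothly by zero.\<close>

definition test_fields :: "'a::euclidean_space set \<Rightarrow> ('a \<Rightarrow> 'a) set" where
  "test_fields K =
     {\<xi>. smooth \<xi> \<and> compact (closure {x. \<xi> x \<noteq> 0}) \<and> closure {x. \<xi> x \<noteq> 0} \<subseteq> interior K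
         \<and> (\<forall>x. norm (\<xi> x) \<le> 1)}"

text \<open>Extended real values: the relative perimeter of a measurable set may be infinite.\<close>

definition rel_perimeter :: "'a::euclidean_space set \<Rightarrow> 'a set \<Rightarrow> ereal" where
  "rel_perimeter K E =
     (SUP \<xi>\<in>test_fields K. ereal (set_lebesgue_integral lebesgue E (divergence \<xi>)))"

definition isoperimetric_profile :: "'a::euclidean_space set \<Rightarrow> real \<Rightarrow> ereal" where
  "isoperimetric_profile K v =
     (INF E\<in>{E. E \<in> sets lebesgue \<and> E \<subseteq> K \<and> vol E = v}. rel_perimeter K E)"

end

theory Submission
  imports Defs
begin

text \<open>
  Let \<open>K = cball x r \<inter> C\<close>, \<open>d = n + 1\<close>, and let \<open>E \<subseteq> K\<close> have finite relative perimeter \<open>P\<close>. The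
  inequality comes from counting, in two ways, the pairs of points of \<open>K\<close> at distance at most a
  well chosen \<open>s\<close> that are separated by \<open>E\<close>.

  Upper bound (\<open>translation_estimate\<close>). For every vector \<open>w\<close>, the set of all \<open>x \<in> E\<close> with
  \<open>x + w \<in> K - E\<close> has measure at most \<open>norm w * P\<close>. For a bump function \<open>\<phi>\<close> that approximates the
  indicator of this set, convexity of \<open>K\<close> keeps the support of \<open>\<phi> (y - t w)\<close> inside the interior of
  \<open>K\<close> for all \<open>t \<in> [0,1]\<close>. So \<open>\<phi> (y - t w) w / norm w\<close> is a test field, and integrating its flux over
  \<open>t\<close> turns the divergence into \<open>(\<phi> y - \<phi> (y - w)) / norm w\<close>. Integration over \<open>norm w \<le> s\<close> bounds
  the measure of the set of pairs by \<open>s P \<omega> s^d\<close>, where \<open>\<omega>\<close> is the volume of the unit ball.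

  Lower bound. Let \<open>F\<close> be the smaller of \<open>E\<close> and \<open>K - E\<close>, \<open>H\<close> the other one, and \<open>m\<close> the volume of
  \<open>F\<close>. The body \<open>K\<close> contains a ball of radius \<open>c r\<close> where \<open>c\<close> depends only on \<open>C\<close> and \<open>r0\<close>
  (\<open>rel_cball_contains_cball\<close>). Shrinking that ball towards a point \<open>x \<in> K\<close> shows that \<open>K \<inter> cball x s\<close>
  has volume at least \<open>\<kappa> s^d\<close>, with \<open>\<kappa> = \<omega> (c / 2)^d\<close>, as long as \<open>s \<le> 2 r\<close>
  (\<open>measure_convex_Int_cball_ge\<close>). For \<open>\<kappa> s^d = 2 m\<close> at least \<open>m\<close> of this
  volume lies in \<open>H\<close>; and if \<open>s > 2 r\<close>, the ball contains all of \<open>H\<close>. Hence the set of pairs has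
  measure at least \<open>m^2\<close>.

  Comparing the two bounds gives \<open>m^2 \<le> s P \<omega> s^d\<close> with \<open>s\<close> proportional to \<open>m^(1/d)\<close>, which is
  \<open>P \<ge> M m^(1 - 1/d)\<close> (\<open>isoperimetric_of_translations\<close>). The volume bounds are the inclusions of
  \<open>K\<close> in a ball of radius \<open>r\<close> and of a ball of radius \<open>c r\<close> in \<open>K\<close>.
\<close>

section \<open>Calculus of smooth functions\<close>

lemma Ck_SucI:
  assumes "\<And>x. (f has_derivative f' x) (at x)" "\<And>h. Ck k (\<lambda>x. f' x h)"
  shows "Ck (Suc k) f"
proof -
  have "frechet_derivative f (at x) = f' x" for x
    using frechet_derivative_at[OF assms(1)] by simp
  then show ?thesis
    using assms by (auto simp: differentiable_def)
qed

lemma Ck_Suc_has_derivative: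
  "Ck (Suc k) f \<Longrightarrow> (f has_derivative frechet_derivative f (at x)) (at x)"
  by (simp add: frechet_derivative_works)

lemma Ck_Suc_imp_Ck: "Ck (Suc k) f \<Longrightarrow> Ck k f"
proof (induction k arbitrary: f)
  case 0
  then show ?case
    by (auto intro!: continuous_at_imp_continuous_on differentiable_imp_continuous_within)
next
  case (Suc k)
  then show ?case by (metis Ck.simps(2))
qed

lemma smooth_has_derivative:
  "smooth f \<Longrightarrow> (f has_derivative frechet_derivative f (at x)) (at x)"
  using Ck_Suc_has_derivative unfolding smooth_def by blast

lemma smooth_frechet_derivative: "smooth f \<Longrightarrow> smooth (\<lambda>x. frechet_derivative f (at x) h)"
  unfolding smooth_def by (metis Ck.simps(2))

lemma smooth_continuous: "smooth f \<Longrightarrow> continuous_on S f"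
  unfolding smooth_def by (metis Ck.simps(1) continuous_on_subset subset_UNIV)

lemma Ck_const: "Ck k (\<lambda>x. c)"
  by (induction k arbitrary: c) (auto intro!: Ck_SucI derivative_eq_intros simp del: Ck.simps(2))

lemma Ck_bounded_linear:
  assumes "bounded_linear L" shows "Ck k L"
proof (cases k)
  case 0
  then show ?thesis using assms by (simp add: linear_continuous_on)
next
  case (Suc j)
  show ?thesis unfolding Suc
    by (rule Ck_SucI[OF bounded_linear_imp_has_derivative[OF assms]]) (rule Ck_const)
qed

lemma Ck_add: "Ck k f \<Longrightarrow> Ck k g \<Longrightarrow> Ck k (\<lambda>x. f x + g x)"
proof (induction k arbitrary: f g)
  case 0
  then show ?case by (auto intro: continuous_on_add)
next
  case (Suc k)
  show ?case
    by (rule Ck_SucI[OF has_derivative_add[OF Ck_Suc_has_derivative Ck_Suc_has_derivative]])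
       (use Suc in auto)
qed

lemma Ck_sum: "(\<And>i. i \<in> I \<Longrightarrow> Ck k (f i)) \<Longrightarrow> Ck k (\<lambda>x. \<Sum>i\<in>I. f i x)"
  by (induction I rule: infinite_finite_induct) (simp_all add: Ck_const Ck_add)

lemma Ck_bilinear:
  assumes B: "bounded_bilinear B"
  shows "Ck k f \<Longrightarrow> Ck k g \<Longrightarrow> Ck k (\<lambda>x. B (f x) (g x))"
proof (induction k arbitrary: f g)
  case 0
  then show ?case by (simp add: bounded_bilinear.continuous_on[OF B])
next
  case (Suc k)
  show ?case
  proof (rule Ck_SucI[OF bounded_bilinear.FDERIV[OF B Ck_Suc_has_derivative Ck_Suc_has_derivative]])
    show "Ck (Suc k) f" "Ck (Suc k) g" by fact+
    show "Ck k (\<lambda>x. B (f x) (frechet_derivative g (at x) h) + B (frechet_derivative f (at x) h) (g x))"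
      for h
      using Suc by (intro Ck_add Suc.IH) (auto dest: Ck_Suc_imp_Ck simp del: Ck.simps(2), auto)
  qed
qed

text \<open>Expanding the derivative of the outer function in the standard basis writes the derivative
  of a composition as a sum of products of functions that are again compositions or derivatives,
  which is what makes the induction on the order close.\<close>

lemma Ck_compose:
  fixes f :: "'a::euclidean_space \<Rightarrow> 'b::euclidean_space"
    and g :: "'b \<Rightarrow> 'c::real_normed_vector"
  shows "Ck k f \<Longrightarrow> Ck k g \<Longrightarrow> Ck k (\<lambda>x. g (f x))"
proof (induction k arbitrary: g)
  case 0
  then show ?case by (auto intro: continuous_on_compose2)
next
  case (Suc k)
  let ?f' = "\<lambda>x. frechet_derivative f (at x)" and ?g' = "\<lambda>y. frechet_derivative g (at y)"
  have f: "(f has_derivative ?f' x) (at x)" for x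
    using Suc.prems(1) by (rule Ck_Suc_has_derivative)
  have g: "(g has_derivative ?g' y) (at y)" for y
    using Suc.prems(2) by (rule Ck_Suc_has_derivative)
  have expand: "?g' (f x) (?f' x h) = (\<Sum>b\<in>Basis. (?f' x h \<bullet> b) *\<^sub>R ?g' (f x) b)" for x h
  proof -
    have "linear (?g' (f x))" using g by (rule has_derivative_linear)
    then have "(\<Sum>b\<in>Basis. (?f' x h \<bullet> b) *\<^sub>R ?g' (f x) b) =
        ?g' (f x) (\<Sum>b\<in>Basis. (?f' x h \<bullet> b) *\<^sub>R b)"
      by (simp add: linear_sum linear_scale)
    then show ?thesis by (simp add: euclidean_representation)
  qed
  show ?case
  proof (rule Ck_SucI[OF has_derivative_compose[OF f g]])
    show "Ck k (\<lambda>x. ?g' (f x) (?f' x h))" for h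
      unfolding expand
    proof (intro Ck_sum Ck_bilinear[OF bounded_bilinear_scaleR])
      fix b :: 'b
      have "Ck k (\<lambda>x. ?f' x h)" using Suc.prems by simp
      then show "Ck k (\<lambda>x. ?f' x h \<bullet> b)"
        by (intro Ck_bilinear[OF bounded_bilinear_inner] Ck_const)
      show "Ck k (\<lambda>x. ?g' (f x) b)"
        using Suc.prems Ck_Suc_imp_Ck[OF Suc.prems(1)] by (intro Suc.IH) auto
    qed
  qed
qed

lemma smooth_compose:
  fixes f :: "'a::euclidean_space \<Rightarrow> 'b::euclidean_space"
  shows "smooth f \<Longrightarrow> smooth g \<Longrightarrow> smooth (\<lambda>x. g (f x))"
  by (simp add: smooth_def Ck_compose)

lemma smooth_translate:
  fixes f :: "'a::euclidean_space \<Rightarrow> 'b::real_normed_vector"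
  assumes "smooth f" shows "smooth (\<lambda>x. f (x - c))"
proof (rule smooth_compose[OF _ assms])
  show "smooth (\<lambda>x. x - c)"
    using Ck_add[OF Ck_bounded_linear[OF bounded_linear_ident] Ck_const[of _ "- c"]]
    by (simp add: smooth_def)
qed

section \<open>Smooth bump functions\<close>

text \<open>The classical flat function \<open>exp (- 1 / x)\<close>, extended by zero, together with its products
  with powers of \<open>1 / x\<close>: the linear span of this family is closed under differentiation, so all its
  members are shown to be smooth by one induction.\<close>

definition flat :: "nat \<Rightarrow> real \<Rightarrow> real" where
  "flat m x = (if x \<le> 0 then 0 else exp (- inverse x) * inverse x ^ m)"

text \<open>A quadratic bound at the origin makes the derivative there vanish. It comes from a single
  term of the exponential series in \<open>1 / x\<close>.\<close>

lemma abs_flat_le: "\<bar>flat m x\<bar> \<le> fact (m + 2) * x\<^sup>2"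
proof (cases "x \<le> 0")
  case False
  define y where "y = inverse x"
  have y: "y > 0" "x = inverse y" using False by (auto simp: y_def)
  have "y ^ (m + 2) / fact (m + 2) \<le> exp y"
    using sum_le_suminf[OF sums_summable[OF exp_converges[of y]], of "{m + 2}"] y(1)
      sums_unique[OF exp_converges[of y]] by (simp add: field_simps del: fact_Suc)
  then have "y ^ m * y\<^sup>2 \<le> fact (m + 2) * exp y"
    by (simp add: field_simps power_add power2_eq_square del: fact_Suc)
  then have "exp (- y) * y ^ m \<le> fact (m + 2) * inverse y ^ 2"
    using y(1) by (simp add: exp_minus divide_simps mult.commute del: fact_Suc)
  then show ?thesis
    using y False by (simp add: flat_def del: fact_Suc)
qed (simp add: flat_def)

lemma flat_has_derivative:
  "(flat m has_field_derivative flat (m + 2) x - real m * flat (m + 1) x) (at x)"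
proof -
  consider "x < 0" | "x = 0" | "x > 0" by linarith
  then show ?thesis
  proof cases
    case 1
    have "((\<lambda>x. 0) has_field_derivative flat (m + 2) x - real m * flat (m + 1) x) (at x)"
      using 1 by (auto simp: flat_def)
    then show ?thesis
      by (rule has_field_derivative_transform_within_open[where S="{..<0}"])
         (use 1 in \<open>auto simp: flat_def\<close>)
  next
    case 2
    have "((\<lambda>h. flat m h / h) \<longlongrightarrow> 0) (at 0)"
    proof (rule Lim_null_comparison)
      show "((\<lambda>h. fact (m + 2) * \<bar>h\<bar>) \<longlongrightarrow> 0) (at (0::real))"
        by (rule tendsto_eq_intros refl | simp)+
      show "\<forall>\<^sub>F h in at 0. norm (flat m h / h) \<le> fact (m + 2) * \<bar>h\<bar>"
      proof (rule eventually_at_filter[THEN iffD2], rule always_eventually, intro allI impI)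
        fix h :: real assume "h \<noteq> 0"
        have "\<bar>flat m h\<bar> \<le> fact (m + 2) * \<bar>h\<bar> * \<bar>h\<bar>"
          using abs_flat_le[of m h] by (simp add: power2_eq_square mult.assoc del: fact_Suc)
        then show "norm (flat m h / h) \<le> fact (m + 2) * \<bar>h\<bar>"
          using \<open>h \<noteq> 0\<close> by (simp add: pos_divide_le_eq del: fact_Suc)
      qed
    qed
    then show ?thesis
      using 2 by (simp add: DERIV_def flat_def)
  next
    case 3
    have "((\<lambda>x. exp (- inverse x) * inverse x ^ m) has_field_derivative
            flat (m + 2) x - real m * flat (m + 1) x) (at x)"
    proof -
      have "((\<lambda>x. exp (- inverse x) * inverse x ^ m) has_field_derivative
          exp (- inverse x) * (inverse x)\<^sup>2 * inverse x ^ m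
          - exp (- inverse x) * (real m * inverse x ^ (m - 1) * (inverse x)\<^sup>2)) (at x)"
        using 3 by (auto intro!: derivative_eq_intros simp: power2_eq_square)
      moreover have eq: "real m * inverse x ^ (m - 1) * (inverse x)\<^sup>2 = real m * inverse x ^ (m + 1)"
        by (cases m) (simp_all add: power2_eq_square)
      have "exp (- inverse x) * (inverse x)\<^sup>2 * inverse x ^ m
          - exp (- inverse x) * (real m * inverse x ^ (m - 1) * (inverse x)\<^sup>2)
          = flat (m + 2) x - real m * flat (m + 1) x"
        unfolding eq using 3 by (simp add: flat_def power2_eq_square mult_ac)
      ultimately show ?thesis by (simp only:)
    qed
    then show ?thesis
      by (rule has_field_derivative_transform_within_open[where S="{0<..}"])
         (use 3 in \<open>auto simp: flat_def\<close>)
  qed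
qed

lemma Ck_flat: "Ck k (flat m)"
proof (induction k arbitrary: m)
  case 0
  show ?case
    using flat_has_derivative by (auto intro!: continuous_at_imp_continuous_on DERIV_isCont)
next
  case (Suc k)
  show ?case
  proof (rule Ck_SucI[OF has_field_derivative_imp_has_derivative[OF flat_has_derivative]])
    fix h :: real
    have "Ck k (\<lambda>x. flat (m + 2) x * h + flat (m + 1) x * (- real m * h))"
      by (intro Ck_add Ck_bilinear[OF bounded_bilinear_mult] Suc.IH Ck_const)
    then show "Ck k (\<lambda>x. (flat (m + 2) x - real m * flat (m + 1) x) * h)"
      by (simp add: algebra_simps)
  qed
qed

lemma Ck_exp: "Ck k (exp :: real \<Rightarrow> real)"
proof (induction k)
  case (Suc k)
  show ?case
    by (rule Ck_SucI[OF has_field_derivative_imp_has_derivative[OF DERIV_exp]])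
       (intro Ck_bilinear[OF bounded_bilinear_mult] Suc.IH Ck_const)
qed (simp add: continuous_on_exp)

text \<open>Finitely many balls inside \<open>G\<close> cover \<open>F\<close>, and each carries a smooth function that is positive
  exactly in the ball. Their sum \<open>S\<close> is bounded below by some \<open>m > 0\<close> on \<open>F\<close>, and \<open>1 - exp (- k S)\<close>
  has values in \<open>[0,1]\<close>, the support of \<open>S\<close>, and values close to 1 on \<open>F\<close> for large \<open>k\<close>. Being only
  close to 1 on \<open>F\<close> is harmless for the limits taken later and avoids a quotient.\<close>

lemma smooth_bump:
  fixes F :: "'a::euclidean_space set"
  assumes "compact F" "open G" "F \<subseteq> G" "0 < e"
  obtains \<phi> :: "'a \<Rightarrow> real" where "smooth \<phi>" "\<And>x. 0 \<le> \<phi> x" "\<And>x. \<phi> x \<le> 1"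
    "\<And>x. x \<in> F \<Longrightarrow> 1 - e \<le> \<phi> x" "compact (closure {x. \<phi> x \<noteq> 0})" "closure {x. \<phi> x \<noteq> 0} \<subseteq> G"
proof -
  have "\<forall>x\<in>F. \<exists>r>0. cball x r \<subseteq> G"
    using assms(2,3) by (auto simp: open_contains_cball)
  from bchoice[OF this] obtain R where R: "\<And>x. x \<in> F \<Longrightarrow> 0 < R x \<and> cball x (R x) \<subseteq> G"
    by auto
  obtain T where T: "T \<subseteq> F" "finite T" "F \<subseteq> (\<Union>c\<in>T. ball c (R c))"
  proof (rule compactE_image[OF assms(1), of F "\<lambda>c. ball c (R c)"])
    show "F \<subseteq> (\<Union>c\<in>F. ball c (R c))"
      using R by (meson UN_I centre_in_ball subsetI)
  qed auto
  define S where "S x = (\<Sum>c\<in>T. flat 0 ((R c)\<^sup>2 - (x - c) \<bullet> (x - c)))" for x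
  have flat_nonneg: "0 \<le> flat 0 y" and flat_pos: "0 < y \<Longrightarrow> 0 < flat 0 y" for y
    by (auto simp: flat_def)
  have inner_less: "(x - c) \<bullet> (x - c) < (R c)\<^sup>2 \<longleftrightarrow> x \<in> ball c (R c)" if "c \<in> T" for x c
  proof -
    have "0 < R c" using R subsetD[OF T(1) that] by simp
    then have "(norm (x - c))\<^sup>2 < (R c)\<^sup>2 \<longleftrightarrow> norm (x - c) < R c"
      using abs_le_square_iff[of "R c" "norm (x - c)"] by (simp add: linorder_not_le[symmetric])
    then show ?thesis
      by (simp only: power2_norm_eq_inner mem_ball dist_norm norm_minus_commute[of c x])
  qed
  have Ck_S: "Ck k S" for k
  proof -
    have "Ck k (\<lambda>x. flat 0 ((R c)\<^sup>2 - (x - c) \<bullet> (x - c)))" for c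
    proof -
      have "Ck k (\<lambda>x. x - c)"
        using Ck_add[OF Ck_bounded_linear[OF bounded_linear_ident] Ck_const[of _ "- c"]] by simp
      then have "Ck k (\<lambda>x. (x - c) \<bullet> - (x - c))"
        by (intro Ck_bilinear[OF bounded_bilinear_inner]
            Ck_compose[OF _ Ck_bounded_linear[OF bounded_linear_minus[OF bounded_linear_ident]]])
      then have "Ck k (\<lambda>x. (R c)\<^sup>2 + (x - c) \<bullet> - (x - c))"
        by (rule Ck_add[OF Ck_const])
      from Ck_compose[OF this Ck_flat[of k 0]] show ?thesis
        by (simp only: inner_minus_right add_uminus_conv_diff)
    qed
    then show ?thesis unfolding S_def by (rule Ck_sum)
  qed
  have S_nonneg: "0 \<le> S x" for x
    unfolding S_def by (intro sum_nonneg flat_nonneg)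
  have S_pos: "0 < S x" if x: "x \<in> F" for x
  proof -
    obtain c where "c \<in> T" "x \<in> ball c (R c)" using subsetD[OF T(3) x] by blast
    then have "0 < flat 0 ((R c)\<^sup>2 - (x - c) \<bullet> (x - c))"
      using inner_less[OF \<open>c \<in> T\<close>, of x] by (intro flat_pos) (simp only: diff_gt_0_iff_gt)
    then show ?thesis
      unfolding S_def by (intro sum_pos2[OF T(2) \<open>c \<in> T\<close>] flat_nonneg)
  qed
  define Z where "Z = (\<Union>c\<in>T. cball c (R c))"
  have Z: "compact Z" "Z \<subseteq> G"
  proof -
    show "compact Z" unfolding Z_def by (intro compact_UN T(2) compact_cball)
    show "Z \<subseteq> G" unfolding Z_def
    proof (rule UN_least)
      fix c assume "c \<in> T"
      then have "c \<in> F" using T(1) by (rule rev_subsetD)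
      then show "cball c (R c) \<subseteq> G" using R by simp
    qed
  qed
  have S_Z: "x \<in> Z" if "S x \<noteq> 0" for x
  proof -
    obtain c where "c \<in> T" "flat 0 ((R c)\<^sup>2 - (x - c) \<bullet> (x - c)) \<noteq> 0"
      using \<open>S x \<noteq> 0\<close> unfolding S_def by (meson sum.neutral)
    then have "(x - c) \<bullet> (x - c) < (R c)\<^sup>2"
      by (simp add: flat_def split: if_splits)
    then have "x \<in> ball c (R c)"
      using inner_less[OF \<open>c \<in> T\<close>] by (simp only:)
    then show ?thesis using \<open>c \<in> T\<close> unfolding Z_def by (intro UN_I[of c]) simp_all
  qed
  obtain m where m: "0 < m" "\<And>x. x \<in> F \<Longrightarrow> m \<le> S x"
  proof (cases "F = {}")
    case False
    have "continuous_on F S"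
      using Ck_S[of 0] continuous_on_subset[of UNIV S F] by simp
    from continuous_attains_inf[OF assms(1) False this]
    obtain y where "y \<in> F" "\<forall>x\<in>F. S y \<le> S x" by (rule bexE) simp
    then show ?thesis using S_pos[of y] that[of "S y"] by simp
  qed (use that[of 1] in auto)
  \<comment> \<open>chosen so that \<open>exp (- k m) \<le> e\<close>; the maximum covers \<open>e \<ge> 1\<close>\<close>
  define k where "k = max 0 (- ln e / m)"
  define \<phi> where "\<phi> x = 1 - exp (- k * S x)" for x
  have k: "0 \<le> k" "- ln e \<le> k * m"
    using m(1) by (auto simp: k_def max_def field_simps)
  show ?thesis
  proof
    have "Ck j (\<lambda>x. 1 + (-1) * exp ((- k) * S x))" for j
    proof (intro Ck_add[OF Ck_const] Ck_bilinear[OF bounded_bilinear_mult Ck_const])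
      show "Ck j (\<lambda>x. exp ((- k) * S x))"
        using Ck_compose[OF Ck_bilinear[OF bounded_bilinear_mult Ck_const Ck_S] Ck_exp] .
    qed
    then show "smooth \<phi>"
      unfolding smooth_def \<phi>_def by simp
    show "0 \<le> \<phi> x" "\<phi> x \<le> 1" for x
      using k(1) S_nonneg by (auto simp: \<phi>_def)
    show "1 - e \<le> \<phi> x" if "x \<in> F" for x
    proof -
      have "- ln e \<le> k * S x"
        using k(2) mult_left_mono[OF m(2)[OF that] k(1)] by linarith
      then have "exp (- k * S x) \<le> exp (ln e)" by simp
      then show ?thesis using \<open>0 < e\<close> by (simp add: \<phi>_def)
    qed
    have "{x. \<phi> x \<noteq> 0} \<subseteq> Z"
      using S_Z by (auto simp: \<phi>_def)
    then have "closure {x. \<phi> x \<noteq> 0} \<subseteq> Z"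
      using Z(1) by (simp add: closure_minimal compact_imp_closed)
    then show "compact (closure {x. \<phi> x \<noteq> 0})" "closure {x. \<phi> x \<noteq> 0} \<subseteq> G"
      using Z compact_closure bounded_subset[OF compact_imp_bounded[OF Z(1)] \<open>{x. \<phi> x \<noteq> 0} \<subseteq> Z\<close>]
      by simp_all
  qed
qed

section \<open>Translating a set against its perimeter\<close>

lemma divergence_directional:
  fixes \<phi> :: "'a::euclidean_space \<Rightarrow> real" and e c :: 'a
  assumes "smooth \<phi>"
  shows "divergence (\<lambda>y. \<phi> (y - c) *\<^sub>R e) y = frechet_derivative \<phi> (at (y - c)) e"
proof -
  let ?D = "frechet_derivative \<phi> (at (y - c))"
  have D: "(\<phi> has_derivative ?D) (at (y - c))"
    using assms by (rule smooth_has_derivative)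
  have "((\<lambda>y. y - c) has_derivative (\<lambda>h. h)) (at y)"
    by (auto intro!: derivative_eq_intros)
  from has_derivative_scaleR_left[OF has_derivative_compose[OF this D]]
  have "frechet_derivative (\<lambda>y. \<phi> (y - c) *\<^sub>R e) (at y) = (\<lambda>h. ?D h *\<^sub>R e)"
    by (rule frechet_derivative_at[symmetric])
  then have "divergence (\<lambda>y. \<phi> (y - c) *\<^sub>R e) y = (\<Sum>b\<in>Basis. (e \<bullet> b) *\<^sub>R ?D b)"
    by (simp add: divergence_def mult.commute)
  also have "\<dots> = ?D (\<Sum>b\<in>Basis. (e \<bullet> b) *\<^sub>R b)"
    using has_derivative_linear[OF D] by (simp add: linear_sum linear_scale)
  finally show ?thesis by (simp add: euclidean_representation)
qed

lemma translated_bump_test_field: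
  fixes \<phi> :: "'a::euclidean_space \<Rightarrow> real" and e c :: 'a
  assumes "smooth \<phi>" "\<And>x. \<bar>\<phi> x\<bar> \<le> 1" "compact (closure {x. \<phi> x \<noteq> 0})"
    and "norm e = 1" "\<And>x. x \<in> closure {x. \<phi> x \<noteq> 0} \<Longrightarrow> c + x \<in> interior K"
  shows "(\<lambda>y. \<phi> (y - c) *\<^sub>R e) \<in> test_fields K"
proof -
  have "e \<noteq> 0" using assms(4) by auto
  then have "{y. \<phi> (y - c) *\<^sub>R e \<noteq> 0} = (+) c ` {x. \<phi> x \<noteq> 0}"
    by (auto simp: image_iff) (metis add.commute diff_add_cancel)
  then have supp: "closure {y. \<phi> (y - c) *\<^sub>R e \<noteq> 0} = (+) c ` closure {x. \<phi> x \<noteq> 0}"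
    by (simp add: closure_translation)
  have "smooth (\<lambda>y. \<phi> (y - c) *\<^sub>R e)"
    using smooth_translate[OF assms(1)]
    unfolding smooth_def by (intro allI Ck_bilinear[OF bounded_bilinear_scaleR _ Ck_const]) simp
  then show ?thesis
    using assms(2-5) unfolding test_fields_def mem_Collect_eq supp
    by (simp add: compact_translation image_subset_iff)
qed

text \<open>The difference \<open>\<phi> y - \<phi> (y - w)\<close> is \<open>norm w\<close> times the integral over \<open>t \<in> [0,1]\<close> of the
  divergence of the translated fields \<open>\<phi> (y - t w) e\<close> with \<open>e = w / norm w\<close>. Each of them is a test
  field, since its support lies in the union of segments from \<open>x\<close> to \<open>x + w\<close> with both ends in the
  interior of the convex set. Fubini's theorem exchanges \<open>t\<close> and \<open>y\<close>.\<close>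

lemma bump_difference_le:
  fixes \<phi> :: "'a::euclidean_space \<Rightarrow> real"
  assumes K: "convex K" and B: "B \<in> sets borel" "bounded B"
    and p: "\<And>\<xi>. \<xi> \<in> test_fields K \<Longrightarrow> (\<integral>y. indicator B y * divergence \<xi> y \<partial>lborel) \<le> p"
    and \<phi>: "smooth \<phi>" "\<And>x. \<bar>\<phi> x\<bar> \<le> 1" "compact (closure {x. \<phi> x \<noteq> 0})"
    and supp: "\<And>x. x \<in> closure {x. \<phi> x \<noteq> 0} \<Longrightarrow> x \<in> interior K \<and> x + w \<in> interior K"
  shows "(\<integral>y. indicator B y * (\<phi> y - \<phi> (y - w)) \<partial>lborel) \<le> norm w * p"
proof (cases "w = 0")
  case False
  define e where "e = w /\<^sub>R norm w"
  have e: "norm e = 1" "w = norm w *\<^sub>R e" using False by (auto simp: e_def)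
  define D where "D y = frechet_derivative \<phi> (at y) e" for y
  have contD: "continuous_on UNIV D"
    unfolding D_def using smooth_continuous[OF smooth_frechet_derivative[OF \<phi>(1)]] .
  have field: "(\<integral>y. indicator B y * D (y - t *\<^sub>R w) \<partial>lborel) \<le> p" if t: "0 \<le> t" "t \<le> 1" for t
  proof -
    have "t *\<^sub>R w + x \<in> interior K" if "x \<in> closure {x. \<phi> x \<noteq> 0}" for x
    proof -
      have "(1 - t) *\<^sub>R x + t *\<^sub>R (x + w) \<in> interior K"
        using convex_interior[OF K] supp[OF that] t by (intro convexD) auto
      then show ?thesis by (simp add: algebra_simps)
    qed
    from p[OF translated_bump_test_field[OF \<phi> e(1) this]] show ?thesis
      unfolding divergence_directional[OF \<phi>(1)] D_def by simp
  qed
  let ?f = "\<lambda>t y. indicator {0..1} t * (indicator B y * D (y - t *\<^sub>R w)) :: real"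
  have int: "integrable (lborel \<Otimes>\<^sub>M lborel) (case_prod ?f)"
  proof -
    have Dc: "continuous_on UNIV (\<lambda>z. D (snd z - fst z *\<^sub>R w))"
      by (rule continuous_on_compose2[OF contD]) (auto intro!: continuous_intros)
    have "compact ({0..1::real} \<times> closure B)"
      using B by (intro compact_Times) auto
    then have "bounded ((\<lambda>z. D (snd z - fst z *\<^sub>R w)) ` ({0..1} \<times> closure B))"
      by (intro compact_imp_bounded compact_continuous_image continuous_on_subset[OF Dc]) auto
    then obtain c where "\<forall>v\<in>(\<lambda>z. D (snd z - fst z *\<^sub>R w)) ` ({0..1} \<times> closure B). norm v \<le> c"
      unfolding bounded_iff by (rule exE)
    then have c: "\<bar>D (snd z - fst z *\<^sub>R w)\<bar> \<le> c" if "z \<in> {0..1} \<times> closure B" for z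
      using that by (simp only: ball_simps real_norm_def)
    have meas: "(\<lambda>z. D (snd z - fst z *\<^sub>R w)) \<in> borel_measurable (lborel \<Otimes>\<^sub>M lborel)"
      using borel_measurable_continuous_onI[OF Dc] by (simp add: lborel_prod)
    have "emeasure (lborel \<Otimes>\<^sub>M lborel) ({0..1::real} \<times> B) = emeasure lborel {0..1::real} * emeasure lborel B"
      using B by (intro lborel.emeasure_pair_measure_Times) auto
    moreover have "emeasure lborel B < \<infinity>"
      using emeasure_bounded_finite[OF B(2)] by simp
    ultimately have fin: "emeasure (lborel \<Otimes>\<^sub>M lborel) ({0..1::real} \<times> B) < \<infinity>"
      by simp
    have "integrable (lborel \<Otimes>\<^sub>M lborel) (\<lambda>z. indicator ({0..1} \<times> B) z *\<^sub>R D (snd z - fst z *\<^sub>R w))"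
    proof (rule integrableI_bounded_set_indicator[OF _ meas fin, where B=c])
      show "{0..1::real} \<times> B \<in> sets (lborel \<Otimes>\<^sub>M lborel)"
        using B(1) by (intro pair_measureI) simp_all
      show "AE z in lborel \<Otimes>\<^sub>M lborel. z \<in> {0..1} \<times> B \<longrightarrow> norm (D (snd z - fst z *\<^sub>R w)) \<le> c"
        using c closure_subset[of B] by (intro AE_I2) force
    qed
    moreover have "(\<lambda>z. indicator ({0..1} \<times> B) z *\<^sub>R D (snd z - fst z *\<^sub>R w)) = case_prod ?f"
      by (auto simp: indicator_def fun_eq_iff)
    ultimately show ?thesis by simp
  qed
  have ftc: "(\<integral>t. ?f t y \<partial>lborel) = indicator B y * (\<phi> y - \<phi> (y - w)) / norm w" for y
  proof -
    have "(\<integral>t. D (y - t *\<^sub>R w) * indicator {0..1} t \<partial>lborel)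
        = - \<phi> (y - 1 *\<^sub>R w) / norm w - (- \<phi> (y - 0 *\<^sub>R w) / norm w)"
    proof (rule integral_FTC_Icc_real)
      fix t :: real
      have "((\<lambda>t. y - t *\<^sub>R w) has_derivative (\<lambda>h. - (h *\<^sub>R w))) (at t)"
        by (auto intro!: derivative_eq_intros)
      from has_derivative_compose[OF this smooth_has_derivative[OF \<phi>(1)]]
      have "((\<lambda>t. \<phi> (y - t *\<^sub>R w)) has_derivative
          (\<lambda>h. frechet_derivative \<phi> (at (y - t *\<^sub>R w)) (- (h *\<^sub>R w)))) (at t)" .
      moreover have "frechet_derivative \<phi> (at (y - t *\<^sub>R w)) (- (h *\<^sub>R w)) = - norm w * D (y - t *\<^sub>R w) * h" for h
      proof -
        have lin: "linear (frechet_derivative \<phi> (at (y - t *\<^sub>R w)))"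
          using smooth_has_derivative[OF \<phi>(1)] by (rule has_derivative_linear)
        have "- (h *\<^sub>R w) = (- h * norm w) *\<^sub>R e" by (subst e(2)) simp
        then show ?thesis by (simp only: linear_scale[OF lin] D_def) simp
      qed
      ultimately have "((\<lambda>t. \<phi> (y - t *\<^sub>R w)) has_real_derivative - norm w * D (y - t *\<^sub>R w)) (at t)"
        by (simp only: has_field_derivative_def)
      then show "((\<lambda>t. - \<phi> (y - t *\<^sub>R w) / norm w) has_real_derivative D (y - t *\<^sub>R w)) (at t)"
        using False by (auto intro!: derivative_eq_intros)
      show "isCont (\<lambda>t. D (y - t *\<^sub>R w)) t"
        by (rule continuous_at_compose[of t "\<lambda>t. y - t *\<^sub>R w" D, unfolded o_def])
           (use contD in \<open>auto intro!: continuous_intros simp: continuous_on_eq_continuous_at\<close>)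
    qed simp
    moreover have "(\<integral>t. ?f t y \<partial>lborel) = indicator B y * (\<integral>t. D (y - t *\<^sub>R w) * indicator {0..1} t \<partial>lborel)"
      by (subst integral_mult_right_zero[symmetric]) (simp add: mult_ac)
    ultimately show ?thesis by (simp add: diff_divide_distrib right_diff_distrib)
  qed
  have "(\<integral>y. indicator B y * (\<phi> y - \<phi> (y - w)) \<partial>lborel) / norm w = (\<integral>y. (\<integral>t. ?f t y \<partial>lborel) \<partial>lborel)"
    unfolding ftc by simp
  also have "\<dots> = (\<integral>t. (\<integral>y. ?f t y \<partial>lborel) \<partial>lborel)"
    by (rule lborel_pair.Fubini_integral[OF int])
  also have "\<dots> \<le> (\<integral>t. indicator {0..1::real} t * p \<partial>lborel)"
  proof (rule integral_mono)
    show "integrable lborel (\<lambda>t. \<integral>y. ?f t y \<partial>lborel)"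
      using lborel_pair.integrable_fst'[OF int] by simp
    show "integrable lborel (\<lambda>t. indicator {0..1::real} t * p)"
      by (intro integrable_mult_left) (auto intro!: integrable_real_indicator)
    show "(\<integral>y. ?f t y \<partial>lborel) \<le> indicator {0..1} t * p" for t
      using field[of t] by (cases "t \<in> {0..1}") auto
  qed
  also have "\<dots> = p" by simp
  finally show ?thesis using False by (simp add: field_simps)
qed simp

text \<open>Apply \<open>bump_difference_le\<close> to bump functions that approximate the indicator of \<open>A\<close>: the
  integral of \<open>\<phi>\<close> over \<open>B\<close> is nearly the measure of \<open>A\<close>, whereas \<open>\<phi> (y - w)\<close> nearly vanishes on \<open>B\<close>
  because \<open>A + w\<close> misses \<open>B\<close>. Points of \<open>A\<close> for which \<open>x\<close> or \<open>x + w\<close> lies on the boundary of \<open>K\<close>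
  cannot be reached by test fields, but they form a null set.\<close>

lemma translation_estimate:
  fixes K :: "'a::euclidean_space set"
  assumes K: "convex_body K" and B: "B \<in> sets borel" "B \<subseteq> K"
    and p: "\<And>\<xi>. \<xi> \<in> test_fields K \<Longrightarrow> (\<integral>y. indicator B y * divergence \<xi> y \<partial>lborel) \<le> p"
    and A: "A \<in> sets borel" "A \<subseteq> B" "\<And>x. x \<in> A \<Longrightarrow> x + w \<in> K - B"
  shows "measure lborel A \<le> norm w * p"
proof -
  have "compact K" "convex K" using K by (auto simp: convex_body_def)
  then have "bounded B"
    using B(2) by (auto intro: bounded_subset compact_imp_bounded)
  then have "bounded A"
    using A(2) by (rule bounded_subset)
  define W where "W = interior K \<inter> (\<lambda>x. x + w) -` interior K"
  have "open W"
    unfolding W_def by (intro open_Int open_vimage open_interior) (auto intro!: continuous_intros)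
  define A' where "A' = A \<inter> W"
  have A'_borel: "A' \<in> sets borel"
    using A(1) \<open>open W\<close> by (auto simp: A'_def)
  have fin: "emeasure lborel S < \<infinity>" if "S \<subseteq> A" for S
    using emeasure_bounded_finite[OF bounded_subset[OF \<open>bounded A\<close> that]] by simp
  have "measure lborel A = measure lborel A'"
  proof -
    have "A - A' \<subseteq> frontier K \<union> (+) (- w) ` frontier K"
    proof
      fix x assume x: "x \<in> A - A'"
      then have "x \<in> K" "x + w \<in> K" using A B(2) by auto
      moreover have "x \<notin> interior K \<or> x + w \<notin> interior K" using x by (auto simp: A'_def W_def)
      ultimately have "x \<in> frontier K \<or> x + w \<in> frontier K"
        by (auto simp: frontier_def closure_subset[THEN subsetD])
      then show "x \<in> frontier K \<union> (+) (- w) ` frontier K"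
        by (auto simp: image_iff intro!: bexI[of _ "x + w"])
    qed
    moreover have "negligible (frontier K)"
      using \<open>convex K\<close> by (rule negligible_convex_frontier)
    ultimately have "negligible (A - A')"
      by (meson negligible_Un negligible_subset negligible_translation)
    then have "A - A' \<in> null_sets lborel"
      using A(1) A'_borel by (auto simp: negligible_iff_null_sets null_sets_def)
    then have "measure lborel (A - (A - A')) = measure lborel A"
      using A(1) by (intro measure_Diff_null_set) auto
    moreover have "A - (A - A') = A'" by (auto simp: A'_def)
    ultimately show ?thesis by simp
  qed
  also have "\<dots> \<le> norm w * p"
  proof (rule field_le_epsilon)
    fix \<epsilon> :: real assume "0 < \<epsilon>"
    define d where "d = \<epsilon> / 3"
    have "0 < d" using \<open>0 < \<epsilon>\<close> by (simp add: d_def)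
    obtain F where F: "closed F" "F \<subseteq> A'" "emeasure lebesgue (A' - F) < ennreal d"
    proof (rule sets_lebesgue_inner_closed)
      show "A' \<in> sets lebesgue" "0 < d" using A'_borel \<open>0 < d\<close> by simp_all
    qed (rule that)
    have "F \<subseteq> A" using F(2) by (auto simp: A'_def)
    have "compact F"
      using F(1) bounded_subset[OF \<open>bounded A\<close> \<open>F \<subseteq> A\<close>] by (simp add: compact_eq_bounded_closed)
    have F_borel: "F \<in> sets borel" using F(1) by auto
    obtain G where G: "open G" "F \<subseteq> G" "emeasure lebesgue (G - F) < ennreal d"
    proof (rule sets_lebesgue_outer_open)
      show "F \<in> sets lebesgue" "0 < d" using F_borel \<open>0 < d\<close> by simp_all
    qed (rule that)
    have "measure lborel A' - measure lborel F = measure lborel (A' - F)"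
      using F(2) fin[of A'] A'_borel F_borel
      by (subst measure_Diff) (auto simp: A'_def)
    also have "\<dots> \<le> d"
      using F(3) A'_borel F_borel \<open>0 < d\<close>
      by (auto simp: measure_def intro!: enn2real_leI)
    finally have A'_F: "measure lborel A' \<le> measure lborel F + d" by simp
    have GF_fin: "emeasure lborel (G - F) < \<infinity>" and GF: "measure lborel (G - F) \<le> d"
      using G(1,3) F_borel \<open>0 < d\<close>
      by (auto simp: measure_def intro!: enn2real_leI intro: order.strict_trans)
    \<comment> \<open>\<open>\<phi> \<ge> 1 - \<eta>\<close> on \<open>F\<close> costs at most \<open>d\<close>; the 1 in the denominator covers null sets \<open>F\<close>\<close>
    define \<eta> where "\<eta> = d / (1 + measure lborel F)"
    have \<eta>: "0 < \<eta>" "\<eta> * measure lborel F \<le> d"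
    proof -
      have "0 < 1 + measure lborel F" by (smt (verit) measure_nonneg)
      then show "0 < \<eta>" "\<eta> * measure lborel F \<le> d"
        using \<open>0 < d\<close> by (auto simp: \<eta>_def field_simps)
    qed
    have "open (G \<inter> W)" "F \<subseteq> G \<inter> W"
      using G(1,2) \<open>open W\<close> F(2) by (auto simp: A'_def)
    from smooth_bump[OF \<open>compact F\<close> this \<eta>(1)]
    obtain \<phi> :: "'a \<Rightarrow> real" where \<phi>: "smooth \<phi>" "\<And>x. 0 \<le> \<phi> x" "\<And>x. \<phi> x \<le> 1"
      "\<And>x. x \<in> F \<Longrightarrow> 1 - \<eta> \<le> \<phi> x" "compact (closure {x. \<phi> x \<noteq> 0})"
      "closure {x. \<phi> x \<noteq> 0} \<subseteq> G \<inter> W"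
      by blast
    have \<phi>_G: "x \<in> G" if "\<phi> x \<noteq> 0" for x
      using \<phi>(6) closure_subset[of "{x. \<phi> x \<noteq> 0}"] that by blast
    have int_GF: "integrable lborel (indicator (G - F) :: 'a \<Rightarrow> real)"
      using GF_fin G(1) F_borel by (intro integrable_real_indicator) auto
    have int_GFw: "integrable lborel (\<lambda>y. indicator (G - F) (- w + y) :: real)"
      and meas_GFw: "(\<integral>y. indicator (G - F) (- w + y) \<partial>lborel) = measure lborel (G - F)"
      using int_GF integrable_distr_eq[of "(+) (- w)" lborel borel "indicator (G - F) :: 'a \<Rightarrow> real"]
        integral_distr[of "(+) (- w)" lborel borel "indicator (G - F) :: 'a \<Rightarrow> real"] G(1) F_borel
      by (auto simp: lborel_distr_plus)
    have int_F: "integrable lborel (indicator F :: 'a \<Rightarrow> real)"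
      using fin[OF \<open>F \<subseteq> A\<close>] F_borel by (intro integrable_real_indicator) auto
    have "measure lborel F - 2 * d \<le> (1 - \<eta>) * measure lborel F - measure lborel (G - F)"
      using \<eta>(2) GF by (simp add: algebra_simps)
    also have "\<dots> = (\<integral>y. (1 - \<eta>) * indicator F y - indicator (G - F) (- w + y) \<partial>lborel)"
      using int_F int_GFw meas_GFw by simp
    also have "\<dots> \<le> (\<integral>y. indicator B y * (\<phi> y - \<phi> (y - w)) \<partial>lborel)"
    proof (rule integral_mono)
      show "integrable lborel (\<lambda>y. (1 - \<eta>) * indicator F y - indicator (G - F) (- w + y))"
        using int_F int_GFw by simp
      have cont: "continuous_on UNIV (\<lambda>y. \<phi> y - \<phi> (y - w))"
        using smooth_continuous[OF \<phi>(1)] smooth_continuous[OF smooth_translate[OF \<phi>(1)]]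
        by (intro continuous_on_diff)
      have "integrable lborel (\<lambda>y. indicator B y *\<^sub>R (\<phi> y - \<phi> (y - w)))"
      proof (rule integrableI_bounded_set_indicator)
        show "B \<in> sets lborel" using B(1) by simp
        show "(\<lambda>y. \<phi> y - \<phi> (y - w)) \<in> borel_measurable lborel"
          using borel_measurable_continuous_onI[OF cont] by simp
        show "emeasure lborel B < \<infinity>"
          using emeasure_bounded_finite[OF \<open>bounded B\<close>] by simp
        show "AE y in lborel. y \<in> B \<longrightarrow> norm (\<phi> y - \<phi> (y - w)) \<le> 1"
          using \<phi>(2,3) by (intro AE_I2) (smt (verit) real_norm_def)
      qed
      then show "integrable lborel (\<lambda>y. indicator B y * (\<phi> y - \<phi> (y - w)))" by simp
      fix y
      have F1: "(1 - \<eta>) * indicator F y \<le> indicator B y * \<phi> y"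
        using \<phi>(2,4)[of y] \<open>F \<subseteq> A\<close> A(2) by (auto simp: indicator_def)
      have "indicator B y * \<phi> (y - w) \<le> indicator (G - F) (- w + y)"
      proof (cases "y \<in> B \<and> \<phi> (y - w) \<noteq> 0")
        case True
        have "y - w \<notin> F"
          using A(3)[of "y - w"] \<open>F \<subseteq> A\<close> True by auto
        then show ?thesis
          using True \<phi>_G[of "y - w"] \<phi>(3)[of "y - w"] by (simp add: indicator_def)
      qed auto
      with F1 show "(1 - \<eta>) * indicator F y - indicator (G - F) (- w + y)
          \<le> indicator B y * (\<phi> y - \<phi> (y - w))"
        by (simp add: right_diff_distrib)
    qed
    also have "\<dots> \<le> norm w * p"
      using \<open>convex K\<close> B(1) \<open>bounded B\<close> p \<phi>
      by (intro bump_difference_le) (auto simp: W_def)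
    finally show "measure lborel A' \<le> norm w * p + \<epsilon>"
      using A'_F by (simp add: d_def)
  qed
  finally show ?thesis .
qed

section \<open>Double counting over translations\<close>

text \<open>Tonelli's theorem for the set of pairs \<open>(x, w)\<close> with \<open>x \<in> F\<close>, \<open>x + w \<in> H\<close> and
  \<open>norm w \<le> s\<close>: the sections over fixed \<open>w\<close> are bounded above, those over fixed \<open>x\<close> below.\<close>

lemma double_count_translations:
  fixes F H :: "'a::euclidean_space set"
  assumes F: "F \<in> sets borel" "bounded F" and H: "H \<in> sets borel" and "0 \<le> s" "0 \<le> p" "0 \<le> m"
    and shift: "\<And>w. measure lborel {x \<in> F. x + w \<in> H} \<le> norm w * p"
    and thick: "\<And>x. x \<in> F \<Longrightarrow> m \<le> measure lborel (H \<inter> cball x s)"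
  shows "m * measure lborel F \<le> s * p * measure lborel (cball (0::'a) s)"
proof -
  let ?f = "\<lambda>w x :: 'a. indicator (cball 0 s) w * (indicator F x * indicator H (x + w)) :: ennreal"
  have fin: "emeasure lborel S = ennreal (measure lborel S)" if "bounded S" for S :: "'a set"
    using emeasure_bounded_finite[OF that] by (intro emeasure_eq_ennreal_measure) auto
  have [measurable]: "F \<in> sets borel" "H \<in> sets borel" by fact+
  have bigger: "ennreal m * indicator F x \<le> (\<integral>\<^sup>+w. ?f w x \<partial>lborel)" for x
  proof (cases "x \<in> F")
    case True
    have "(\<integral>\<^sup>+w. ?f w x \<partial>lborel) = (\<integral>\<^sup>+w. indicator (H \<inter> cball x s) (x + w) \<partial>lborel)"
      using True by (intro nn_integral_cong) (auto simp: indicator_def dist_norm)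
    also have "\<dots> = (\<integral>\<^sup>+z. indicator (H \<inter> cball x s) z \<partial>distr lborel borel ((+) x))"
      by (rule nn_integral_distr[symmetric]) (measurable, simp)
    also have "\<dots> = emeasure lborel (H \<inter> cball x s)"
      unfolding lborel_distr_plus by simp
    also have "\<dots> = ennreal (measure lborel (H \<inter> cball x s))"
      by (rule fin) (auto intro: bounded_subset[OF bounded_cball])
    finally show ?thesis
      using thick[OF True] True by (simp add: ennreal_leI)
  qed simp
  have smaller: "(\<integral>\<^sup>+x. ?f w x \<partial>lborel) \<le> ennreal (s * p) * indicator (cball 0 s) w" for w
  proof (cases "w \<in> cball 0 s")
    case True
    have "(\<integral>\<^sup>+x. ?f w x \<partial>lborel) = (\<integral>\<^sup>+x. indicator {x \<in> F. x + w \<in> H} x \<partial>lborel)"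
      using True by (intro nn_integral_cong) (auto simp: indicator_def)
    also have "\<dots> = emeasure lborel {x \<in> F. x + w \<in> H}"
      by (subst nn_integral_indicator) auto
    also have "\<dots> = ennreal (measure lborel {x \<in> F. x + w \<in> H})"
      by (rule fin) (auto intro: bounded_subset[OF F(2)])
    also have "\<dots> \<le> ennreal (s * p)"
      using shift[of w] mult_right_mono[of "norm w" s p] True \<open>0 \<le> p\<close>
      by (intro ennreal_leI) (auto intro: order_trans)
    finally show ?thesis using True by simp
  qed simp
  have "ennreal (m * measure lborel F) = (\<integral>\<^sup>+x. ennreal m * indicator F x \<partial>lborel)"
    using \<open>0 \<le> m\<close> by (simp add: nn_integral_cmult_indicator fin[OF F(2)] ennreal_mult)
  also have "\<dots> \<le> (\<integral>\<^sup>+x. (\<integral>\<^sup>+w. ?f w x \<partial>lborel) \<partial>lborel)"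
    by (intro nn_integral_mono bigger)
  also have "\<dots> = (\<integral>\<^sup>+w. (\<integral>\<^sup>+x. ?f w x \<partial>lborel) \<partial>lborel)"
  proof (rule lborel_pair.Fubini')
    have "(\<lambda>z. indicator (cball 0 s) (fst z) :: ennreal) \<in> borel_measurable (lborel \<Otimes>\<^sub>M lborel)"
      "(\<lambda>z. indicator F (snd z) :: ennreal) \<in> borel_measurable (lborel \<Otimes>\<^sub>M lborel)"
      "(\<lambda>z. indicator H (snd z + fst z) :: ennreal) \<in> borel_measurable (lborel \<Otimes>\<^sub>M lborel)"
      by (rule measurable_compose[OF _ borel_measurable_indicator, of _ _ borel]; simp)+
    then show "case_prod ?f \<in> borel_measurable (lborel \<Otimes>\<^sub>M lborel)"
      unfolding case_prod_beta' by (intro borel_measurable_times_ennreal)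
  qed
  also have "\<dots> \<le> (\<integral>\<^sup>+w. ennreal (s * p) * indicator (cball (0::'a) s) w \<partial>lborel)"
    by (intro nn_integral_mono smaller)
  also have "\<dots> = ennreal (s * p * measure lborel (cball (0::'a) s))"
    using \<open>0 \<le> s\<close> \<open>0 \<le> p\<close>
    by (simp add: nn_integral_cmult_indicator fin[OF bounded_cball] ennreal_mult)
  finally show ?thesis
    using \<open>0 \<le> s\<close> \<open>0 \<le> p\<close> by (simp add: ennreal_le_iff)
qed

section \<open>Balls inside convex sets\<close>

lemma cball_homothety:
  fixes x y z :: "'a::real_normed_vector"
  assumes "0 < t" "z \<in> cball (x + t *\<^sub>R (y - x)) (t * \<rho>)"
  obtains u where "u \<in> cball y \<rho>" "z = (1 - t) *\<^sub>R x + t *\<^sub>R u"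
proof
  let ?u = "x + (z - x) /\<^sub>R t"
  have "t *\<^sub>R (y - ?u) = x + t *\<^sub>R (y - x) - z"
    using \<open>0 < t\<close> by (simp add: algebra_simps)
  then have "t * norm (y - ?u) \<le> t * \<rho>"
    using assms by (metis abs_of_pos dist_norm mem_cball norm_scaleR)
  then show "?u \<in> cball y \<rho>"
    using \<open>0 < t\<close> by (simp add: dist_norm)
  show "z = (1 - t) *\<^sub>R x + t *\<^sub>R ?u"
    using \<open>0 < t\<close> by (simp add: algebra_simps)
qed

text \<open>The homothety with centre \<open>x\<close> and ratio \<open>t \<le> 1\<close> maps the convex set \<open>K\<close> into itself.\<close>

lemma cball_subset_convex_Int_cball:
  fixes K :: "'a::real_normed_vector set"
  assumes "convex K" "x \<in> K" "cball y \<rho> \<subseteq> K" "cball y \<rho> \<subseteq> cball x R" "0 < t" "t \<le> 1"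
  shows "cball (x + t *\<^sub>R (y - x)) (t * \<rho>) \<subseteq> K \<inter> cball x (t * R)"
proof
  fix z assume "z \<in> cball (x + t *\<^sub>R (y - x)) (t * \<rho>)"
  from cball_homothety[OF \<open>0 < t\<close> this]
  obtain u where u: "u \<in> cball y \<rho>" "z = (1 - t) *\<^sub>R x + t *\<^sub>R u" .
  have "z \<in> K"
    unfolding u(2) using assms u(1) by (intro convexD) auto
  moreover have "z \<in> cball x (t * R)"
  proof -
    have "x - z = t *\<^sub>R (x - u)" by (simp add: u(2) algebra_simps)
    moreover have "norm (x - u) \<le> R" using u(1) assms(4) by (auto simp: dist_norm subset_eq)
    ultimately show ?thesis using \<open>0 < t\<close> by (simp add: dist_norm)
  qed
  ultimately show "z \<in> K \<inter> cball x (t * R)" by simp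
qed

text \<open>Shrinking one fixed ball of \<open>C\<close> towards \<open>x\<close> by a ratio proportional to \<open>r\<close> brings it within
  distance \<open>r\<close> of \<open>x\<close>, so one constant serves all \<open>x\<close> and \<open>r\<close>.\<close>

lemma rel_cball_contains_cball:
  fixes C :: "'a::euclidean_space set"
  assumes "convex_body C" "0 < r0"
  obtains c where "0 < c"
    "\<And>x r. \<lbrakk>x \<in> C; 0 < r; r \<le> r0\<rbrakk> \<Longrightarrow> \<exists>y. cball y (c * r) \<subseteq> rel_cball C x r"
proof -
  have C: "bounded C" "convex C" "interior C \<noteq> {}"
    using assms(1) by (auto simp: convex_body_def compact_imp_bounded)
  obtain q \<rho> where \<rho>: "0 < \<rho>" "cball q \<rho> \<subseteq> C"
    using C(3) by (auto simp: mem_interior_cball)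
  obtain R where R: "\<And>x. x \<in> C \<Longrightarrow> dist q x \<le> R"
    using C(1) bounded_any_center[of C q] by auto
  have "q \<in> C" using \<rho> by (auto simp: subset_eq)
  then have "0 \<le> R" using R[of q] by simp
  \<comment> \<open>\<open>R + \<rho> \<le> L\<close> puts the ball shrunk by the ratio \<open>r / L\<close> within \<open>r\<close> of \<open>x\<close>, and \<open>r0 \<le> L\<close> makes
     the ratio at most 1\<close>
  define L where "L = r0 + R + \<rho>"
  have L: "0 < L" "R + \<rho> \<le> L" "r0 \<le> L" using \<open>0 \<le> R\<close> \<rho>(1) assms(2) by (auto simp: L_def)
  show ?thesis
  proof
    show "0 < \<rho> / L" using L \<rho>(1) by simp
    fix x r assume x: "x \<in> C" "0 < r" "r \<le> r0"
    define t where "t = r / L"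
    have t: "0 < t" "t \<le> 1" using x L by (auto simp: t_def)
    have "cball q \<rho> \<subseteq> cball x (R + \<rho>)"
    proof
      fix u assume "u \<in> cball q \<rho>"
      then show "u \<in> cball x (R + \<rho>)"
        using R[OF x(1)] dist_triangle[of x u q] by (simp add: dist_commute)
    qed
    from cball_subset_convex_Int_cball[OF C(2) x(1) \<rho>(2) this t]
    have "cball (x + t *\<^sub>R (q - x)) (t * \<rho>) \<subseteq> C \<inter> cball x (t * (R + \<rho>))" .
    moreover have "t * (R + \<rho>) \<le> r"
      using L x(2) mult_left_mono[OF L(2), of r] by (simp add: t_def field_simps)
    ultimately have "cball (x + t *\<^sub>R (q - x)) (t * \<rho>) \<subseteq> rel_cball C x r"
      by (auto simp: rel_cball_def subset_eq)
    moreover have "t * \<rho> = \<rho> / L * r" by (simp add: t_def)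
    ultimately show "\<exists>y. cball y (\<rho> / L * r) \<subseteq> rel_cball C x r" by metis
  qed
qed

section \<open>The relative isoperimetric inequality\<close>

lemma measure_cball_eq:
  "0 \<le> r \<Longrightarrow> measure lborel (cball (x::'a::euclidean_space) r) = unit_ball_vol (real DIM('a)) * r ^ DIM('a)"
  by (simp add: content_cball)

text \<open>The set \<open>K\<close> has diameter at most \<open>2 r\<close>, so the homothety with centre \<open>x\<close> and ratio \<open>s / (2 r)\<close>
  moves the ball of radius \<open>c r\<close> into \<open>cball x s\<close>.\<close>

lemma measure_convex_Int_cball_ge:
  fixes K :: "'a::euclidean_space set"
  assumes "compact K" "convex K" "K \<subseteq> cball x0 r" "cball y (c * r) \<subseteq> K" "0 < c" "0 < r"
    and "x \<in> K" "0 < s" "s \<le> 2 * r"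
  shows "unit_ball_vol (real DIM('a)) * (c * s / 2) ^ DIM('a) \<le> measure lborel (K \<inter> cball x s)"
proof -
  define t where "t = s / (2 * r)"
  have t: "0 < t" "t \<le> 1" "t * (c * r) = c * s / 2" "t * (2 * r) = s"
    using assms by (auto simp: t_def)
  have "K \<subseteq> cball x (2 * r)"
  proof
    fix z assume "z \<in> K"
    then have "dist x0 z \<le> r" "dist x0 x \<le> r" using assms(3,7) by auto
    then show "z \<in> cball x (2 * r)" using dist_triangle3[of x z x0] by simp
  qed
  with assms(4) have "cball y (c * r) \<subseteq> cball x (2 * r)" by (rule order_trans)
  from cball_subset_convex_Int_cball[OF assms(2,7,4) this t(1,2)]
  have sub: "cball (x + t *\<^sub>R (y - x)) (c * s / 2) \<subseteq> K \<inter> cball x s"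
    by (simp only: t(3,4))
  have "unit_ball_vol (real DIM('a)) * (c * s / 2) ^ DIM('a)
      = measure lborel (cball (x + t *\<^sub>R (y - x)) (c * s / 2))"
    using assms by (intro measure_cball_eq[symmetric]) simp
  also have "\<dots> \<le> measure lborel (K \<inter> cball x s)"
    using assms(1) by (intro measure_mono_fmeasurable[OF sub])
      (auto intro!: fmeasurable_compact compact_Int)
  finally show ?thesis .
qed

lemma sets_borel_translate:
  fixes A B :: "'a::euclidean_space set"
  assumes "A \<in> sets borel" "B \<in> sets borel"
  shows "{x \<in> A. x + w \<in> B} \<in> sets borel"
proof -
  have "(\<lambda>x. x + w) -` B \<inter> space borel \<in> sets borel"
    using assms(2) by (intro measurable_sets) auto
  moreover have "{x \<in> A. x + w \<in> B} = A \<inter> ((\<lambda>x. x + w) -` B \<inter> space borel)" by auto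
  ultimately show ?thesis using assms(1) by simp
qed

text \<open>The radius \<open>s\<close> is the one at which the volume guaranteed for \<open>K \<inter> cball x s\<close> is twice that of
  \<open>F\<close>, so that \<open>F\<close> cannot fill more than half of it.\<close>

lemma isoperimetric_of_translations:
  fixes K F H :: "'a::euclidean_space set"
  assumes K: "compact K" "convex K" "K \<subseteq> cball x0 r" "cball y (c * r) \<subseteq> K" "0 < c" "0 < r"
    and FH: "F \<in> sets borel" "H \<in> sets borel" "F \<union> H = K" "F \<inter> H = {}"
    and less: "0 < measure lborel F" "measure lborel F \<le> measure lborel H"
    and shift: "\<And>w. measure lborel {x \<in> F. x + w \<in> H} \<le> norm w * p" and "0 \<le> p"
    and d: "d = DIM('a)" and \<kappa>: "\<kappa> = unit_ball_vol (real d) * (c / 2) ^ d"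
  shows "\<kappa> / (2 * unit_ball_vol (real d)) * (\<kappa> / 2) powr (1 / real d) *
      measure lborel F powr (1 - 1 / real d) \<le> p"
proof -
  let ?\<omega> = "unit_ball_vol (real d)"
  define m where "m = measure lborel F"
  have "0 < m" using less by (simp add: m_def)
  have "0 < d" by (simp add: d)
  have "0 < ?\<omega>" by simp
  have "0 < \<kappa>" using \<open>0 < c\<close> by (simp add: \<kappa>)
  define s where "s = (2 * m / \<kappa>) powr (1 / real d)"
  have "0 < s" using \<open>0 < m\<close> \<open>0 < \<kappa>\<close> by (simp add: s_def)
  have s_pow: "\<kappa> * s ^ d = 2 * m"
    using \<open>0 < m\<close> \<open>0 < \<kappa>\<close> \<open>0 < d\<close> by (simp add: s_def powr_powr flip: powr_realpow)
  have "F \<subseteq> K" "H \<subseteq> K" using FH by auto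
  have fin: "S \<in> fmeasurable lborel" if "S \<in> sets borel" "S \<subseteq> K" for S
    using that(1) emeasure_bounded_finite[OF bounded_subset[OF compact_imp_bounded[OF K(1)] that(2)]]
    by (simp add: fmeasurable_def)
  \<comment> \<open>for \<open>s > 2 r\<close>, where the volume bound is not available, the ball is so large that it contains \<open>H\<close>\<close>
  have thick: "m \<le> measure lborel (H \<inter> cball x s)" if "x \<in> F" for x
  proof (cases "s \<le> 2 * r")
    case True
    have "x \<in> K" using that \<open>F \<subseteq> K\<close> by auto
    have "2 * m = ?\<omega> * (c * s / 2) ^ d"
      unfolding s_pow[symmetric] \<kappa> by (simp add: power_mult_distrib power_divide)
    also have "\<dots> \<le> measure lborel (K \<inter> cball x s)"
      using measure_convex_Int_cball_ge[OF K \<open>x \<in> K\<close> \<open>0 < s\<close> True] by (simp add: d)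
    also have "\<dots> \<le> measure lborel (F \<union> (H \<inter> cball x s))"
      using FH by (intro measure_mono_fmeasurable fmeasurable.Un fin) (auto simp: borel_compact[OF K(1)])
    also have "\<dots> \<le> m + measure lborel (H \<inter> cball x s)"
      unfolding m_def using FH by (intro measure_Un_le) auto
    finally show ?thesis by simp
  next
    case False
    have "H \<subseteq> cball x s"
    proof
      fix z assume "z \<in> H"
      then have "dist x0 z \<le> r" "dist x0 x \<le> r" using K(3) that \<open>F \<subseteq> K\<close> \<open>H \<subseteq> K\<close> by auto
      then show "z \<in> cball x s" using False dist_triangle3[of x z x0] by simp
    qed
    then have "H \<inter> cball x s = H" by auto
    then show ?thesis using less(2) by (simp add: m_def)
  qed
  have "m * m \<le> s * p * measure lborel (cball (0::'a) s)"
    using double_count_translations[of F H s p m, folded m_def] FH \<open>0 < s\<close> \<open>0 \<le> p\<close> \<open>0 < m\<close> shift thick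
      bounded_subset[OF compact_imp_bounded[OF K(1)] \<open>F \<subseteq> K\<close>] by simp
  also have "\<dots> = s * p * ?\<omega> * s ^ d"
    using \<open>0 < s\<close> by (simp add: measure_cball_eq d)
  also have "\<dots> = s * p * ?\<omega> * (2 * m / \<kappa>)"
    using s_pow \<open>0 < \<kappa>\<close> by (simp add: field_simps)
  finally have "m * m \<le> m * (s * p * ?\<omega> * 2 / \<kappa>)"
    by (simp add: mult_ac)
  then have "m \<le> s * p * ?\<omega> * 2 / \<kappa>"
    using \<open>0 < m\<close> by (simp only: mult_le_cancel_left_pos)
  then have "\<kappa> / (2 * ?\<omega>) * (m / s) \<le> p"
    using \<open>0 < s\<close> \<open>0 < \<kappa>\<close> \<open>0 < ?\<omega>\<close> by (simp add: field_simps)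
  moreover have "m / s = (\<kappa> / 2) powr (1 / real d) * m powr (1 - 1 / real d)"
    using \<open>0 < m\<close> \<open>0 < \<kappa>\<close> by (simp add: s_def powr_divide powr_mult powr_diff)
  ultimately show ?thesis unfolding mult.assoc m_def[symmetric] by (simp only:)
qed

text \<open>Double counting needs measurability of \<open>{(x, w). x + w \<in> E}\<close> in the product of Borel
  measures, so a Lebesgue set is replaced by a Borel set that has the same volume and flux integrals.\<close>

lemma lebesgue_set_borel_part:
  assumes "E \<in> sets lebesgue"
  obtains B where "B \<in> sets borel" "B \<subseteq> E" "E - B \<in> null_sets lebesgue"
proof -
  obtain C T where CT: "fsigma C" "T \<in> null_sets lebesgue" "C \<union> T = E" "disjnt C T"
    using lebesgue_set_almost_fsigma[OF assms] .
  have "C \<in> sets borel"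
    using CT(1) by (auto elim!: fsigma.cases)
  moreover have "E - C = T" using CT(3,4) by (auto simp: disjnt_def)
  ultimately show ?thesis using that CT by auto
qed

text \<open>Translations from \<open>E\<close> into its complement by \<open>w\<close> and from the complement into \<open>E\<close> by \<open>- w\<close>
  move sets of equal measure. Hence the bound by the perimeter of \<open>E\<close> also serves when the complement
  is the smaller part.\<close>

lemma rel_perimeter_ge:
  fixes K E :: "'a::euclidean_space set"
  assumes K: "convex_body K" "K \<subseteq> cball x0 r" "cball y (c * r) \<subseteq> K" "0 < c" "0 < r"
    and E: "E \<in> sets lebesgue" "E \<subseteq> K" "0 < vol E" "vol E < vol K"
    and d: "d = DIM('a)" and \<kappa>: "\<kappa> = unit_ball_vol (real d) * (c / 2) ^ d"
  shows "ereal (\<kappa> / (2 * unit_ball_vol (real d)) * (\<kappa> / 2) powr (1 / real d) *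
      min (vol E) (vol K - vol E) powr (1 - 1 / real d)) \<le> rel_perimeter K E"
proof (cases "rel_perimeter K E = \<infinity>")
  case False
  have compact: "compact K" and convex: "convex K" using K(1) by (auto simp: convex_body_def)
  obtain B where B: "B \<in> sets borel" "B \<subseteq> E" "E - B \<in> null_sets lebesgue"
    using lebesgue_set_borel_part[OF E(1)] .
  have "B \<subseteq> K" using B(2) E(2) by auto
  have integral_E: "set_lebesgue_integral lebesgue E (divergence \<xi>) =
      (\<integral>y. indicator B y * divergence \<xi> y \<partial>lborel)" if "\<xi> \<in> test_fields K" for \<xi>
  proof -
    have "continuous_on UNIV (divergence \<xi>)"
      unfolding divergence_def using that
      by (intro continuous_on_sum continuous_on_inner continuous_on_const)
        (simp_all add: test_fields_def smooth_continuous smooth_frechet_derivative)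
    then have [measurable]: "divergence \<xi> \<in> borel_measurable borel"
      by (rule borel_measurable_continuous_onI)
    have [measurable]: "E \<in> sets lebesgue" "B \<in> sets borel" by fact+
    have "set_lebesgue_integral lebesgue E (divergence \<xi>) =
        (\<integral>y. indicator B y * divergence \<xi> y \<partial>lebesgue)"
      unfolding set_lebesgue_integral_def real_scaleR_def
    proof (rule integral_cong_AE)
      show "AE y in lebesgue. indicator E y * divergence \<xi> y = indicator B y * divergence \<xi> y"
        using AE_not_in[OF B(3)] by eventually_elim (use B(2) in \<open>auto simp: indicator_def\<close>)
      show "(\<lambda>y. indicator E y * divergence \<xi> y) \<in> borel_measurable lebesgue"
        by (intro borel_measurable_times borel_measurable_indicator E(1) measurable_completion) simp
      show "(\<lambda>y. indicator B y * divergence \<xi> y) \<in> borel_measurable lebesgue"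
        by (intro measurable_completion) simp
    qed
    also have "\<dots> = (\<integral>y. indicator B y * divergence \<xi> y \<partial>lborel)"
      by (rule integral_completion) simp
    finally show ?thesis .
  qed
  have zero: "(\<lambda>x. 0) \<in> test_fields K"
    by (simp add: test_fields_def smooth_def Ck_const)
  have upper: "ereal (set_lebesgue_integral lebesgue E (divergence \<xi>)) \<le> rel_perimeter K E"
    if "\<xi> \<in> test_fields K" for \<xi>
    unfolding rel_perimeter_def using that by (rule SUP_upper)
  have "divergence (\<lambda>x. 0 :: 'a) = (\<lambda>x. 0)"
    by (simp add: divergence_def fun_eq_iff)
  then have "0 \<le> rel_perimeter K E"
    using upper[OF zero] by (simp add: zero_ereal_def set_lebesgue_integral_def)
  then obtain p where p: "rel_perimeter K E = ereal p" "0 \<le> p"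
    using False by (cases "rel_perimeter K E") auto
  have flux: "(\<integral>y. indicator B y * divergence \<xi> y \<partial>lborel) \<le> p" if "\<xi> \<in> test_fields K" for \<xi>
    using upper[OF that] unfolding integral_E[OF that] p(1) by simp
  define H where "H = K - B"
  have K_borel: "K \<in> sets borel" using compact by (rule borel_compact)
  then have H: "H \<in> sets borel" "B \<union> H = K" "B \<inter> H = {}" "H \<union> B = K" "H \<inter> B = {}"
    using B(1) \<open>B \<subseteq> K\<close> by (auto simp: H_def)
  have vol_B: "measure lborel B = vol E"
  proof -
    have "vol (E - (E - B)) = vol E"
      using B(3) E(1) by (intro measure_Diff_null_set) auto
    moreover have "E - (E - B) = B" using B(2) by auto
    ultimately show ?thesis using B(1) by simp
  qed
  have vol_H: "measure lborel H = vol K - vol E"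
  proof -
    have "emeasure lborel K \<noteq> \<infinity>"
      using emeasure_bounded_finite[OF compact_imp_bounded[OF compact]] by auto
    then show ?thesis
      unfolding H_def using B(1) \<open>B \<subseteq> K\<close> K_borel
      by (subst measure_Diff) (auto simp: vol_B)
  qed
  have shift_B: "measure lborel {x \<in> B. x + w \<in> H} \<le> norm w * p" for w
  proof (rule translation_estimate[OF K(1) B(1) \<open>B \<subseteq> K\<close> flux])
    show "{x \<in> B. x + w \<in> H} \<in> sets borel"
      using B(1) H(1) by (rule sets_borel_translate)
  qed (auto simp: H_def)
  have shift_H: "measure lborel {x \<in> H. x + w \<in> B} \<le> norm w * p" for w
  proof -
    have "{x \<in> H. x + w \<in> B} = (+) (- w) ` {x \<in> B. x + (- w) \<in> H}"
      by (auto simp: image_iff) (metis add_diff_cancel)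
    then have "measure lebesgue {x \<in> H. x + w \<in> B} = measure lebesgue {x \<in> B. x + (- w) \<in> H}"
      by (simp only: measure_translation)
    moreover have "{x \<in> H. x + w \<in> B} \<in> sets borel" "{x \<in> B. x + (- w) \<in> H} \<in> sets borel"
      using B(1) H(1) by (auto intro: sets_borel_translate)
    ultimately show ?thesis using shift_B[of "- w"] by simp
  qed
  have "\<kappa> / (2 * unit_ball_vol (real d)) * (\<kappa> / 2) powr (1 / real d) *
      min (vol E) (vol K - vol E) powr (1 - 1 / real d) \<le> p"
  proof (cases "vol E \<le> vol K - vol E")
    case True
    then show ?thesis
      using isoperimetric_of_translations[OF compact convex K(2-5) B(1) H(1,2,3) _ _ shift_B p(2) d \<kappa>] E
      by (simp add: vol_B vol_H)
  next
    case False
    then show ?thesis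
      using isoperimetric_of_translations[OF compact convex K(2-5) H(1) B(1) H(4,5) _ _ shift_H p(2) d \<kappa>] E
      by (simp add: vol_B vol_H)
  qed
  then show ?thesis by (simp add: p(1))
qed simp

theorem theorem4p12:
  fixes n :: nat
  assumes "n \<ge> 1" and "DIM('a::euclidean_space) = n + 1"
  shows "\<exists>l2>0. \<forall>C::'a set. convex_body C \<longrightarrow> (\<forall>r0>0. \<exists>M>0. \<exists>l1>0.
    (\<forall>x\<in>C. \<forall>r v. 0 < r \<and> r \<le> r0 \<and> 0 < v \<and> v < vol (rel_cball C x r) \<longrightarrow>
        isoperimetric_profile (rel_cball C x r) v
          \<ge> ereal (M * min v (vol (rel_cball C x r) - v) powr (real n / real (n + 1)))) \<and>
    (\<forall>x\<in>C. \<forall>r. 0 < r \<and> r \<le> r0 \<longrightarrow>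
        l1 * r ^ (n + 1) \<le> vol (rel_cball C x r) \<and> vol (rel_cball C x r) \<le> l2 * r ^ (n + 1)))"
proof -
  define d where "d = n + 1"
  have d: "d = DIM('a)" "1 - 1 / real d = real n / real (n + 1)"
    using assms by (auto simp: d_def field_simps)
  let ?\<omega> = "unit_ball_vol (real d)"
  have vol_cball: "vol (cball (x::'a) r) = ?\<omega> * r ^ d" if "0 \<le> r" for x r
    using measure_cball_eq[OF that, of x] by (simp add: d(1))
  show ?thesis
  proof (rule exI[of _ ?\<omega>], rule conjI, simp, intro allI impI)
    fix C :: "'a set" and r0 :: real
    assume C: "convex_body C" and "0 < r0"
    then obtain c where c: "0 < c" "\<And>x r. \<lbrakk>x \<in> C; 0 < r; r \<le> r0\<rbrakk> \<Longrightarrow> \<exists>y. cball y (c * r) \<subseteq> rel_cball C x r"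
      using rel_cball_contains_cball by blast
    have rel: "compact (rel_cball C x r)" "convex (rel_cball C x r)" "rel_cball C x r \<subseteq> cball x r" for x r
      using C by (auto simp: rel_cball_def convex_body_def intro!: convex_Int)
    then have lmeas: "rel_cball C x r \<in> lmeasurable" for x r
      by (intro lmeasurable_compact)
    define \<kappa> where "\<kappa> = ?\<omega> * (c / 2) ^ d"
    define M where "M = \<kappa> / (2 * ?\<omega>) * (\<kappa> / 2) powr (1 / real d)"
    have "0 < \<kappa>" using c(1) by (simp add: \<kappa>_def)
    then have "0 < M" by (simp add: M_def)
    show "\<exists>M>0. \<exists>l1>0.
      (\<forall>x\<in>C. \<forall>r v. 0 < r \<and> r \<le> r0 \<and> 0 < v \<and> v < vol (rel_cball C x r) \<longrightarrow>
        isoperimetric_profile (rel_cball C x r) v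
          \<ge> ereal (M * min v (vol (rel_cball C x r) - v) powr (real n / real (n + 1)))) \<and>
      (\<forall>x\<in>C. \<forall>r. 0 < r \<and> r \<le> r0 \<longrightarrow>
        l1 * r ^ (n + 1) \<le> vol (rel_cball C x r) \<and> vol (rel_cball C x r) \<le> ?\<omega> * r ^ (n + 1))"
    proof (rule exI[of _ M], rule conjI[OF \<open>0 < M\<close>], rule exI[of _ "?\<omega> * c ^ d"],
        intro conjI ballI allI impI)
      show "0 < ?\<omega> * c ^ d" using c(1) by simp
    next
      fix x r v assume "x \<in> C" and rv: "0 < r \<and> r \<le> r0 \<and> 0 < v \<and> v < vol (rel_cball C x r)"
      then obtain y where y: "cball y (c * r) \<subseteq> rel_cball C x r" using c(2) by blast
      have "y \<in> interior (rel_cball C x r)"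
        unfolding mem_interior_cball using y c(1) rv by (intro exI[of _ "c * r"]) simp
      then have body: "convex_body (rel_cball C x r)"
        using rel by (auto simp: convex_body_def)
      show "ereal (M * min v (vol (rel_cball C x r) - v) powr (real n / real (n + 1)))
          \<le> isoperimetric_profile (rel_cball C x r) v"
        unfolding isoperimetric_profile_def
      proof (rule INF_greatest)
        fix E :: "'a set" assume "E \<in> {E. E \<in> sets lebesgue \<and> E \<subseteq> rel_cball C x r \<and> vol E = v}"
        then show "ereal (M * min v (vol (rel_cball C x r) - v) powr (real n / real (n + 1)))
            \<le> rel_perimeter (rel_cball C x r) E"
          using rel_perimeter_ge[OF body rel(3) y c(1) _ _ _ _ _ d(1) \<kappa>_def, of E] rv
          unfolding M_def d(2) by auto
      qed
    next
      fix x r assume "x \<in> C" and r: "0 < r \<and> r \<le> r0"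
      then obtain y where y: "cball y (c * r) \<subseteq> rel_cball C x r" using c(2) by blast
      have "vol (cball y (c * r)) \<le> vol (rel_cball C x r)"
        by (rule measure_mono_fmeasurable[OF y _ lmeas]) simp
      then show "?\<omega> * c ^ d * r ^ (n + 1) \<le> vol (rel_cball C x r)"
        using vol_cball[of "c * r" y] c(1) r by (simp add: power_mult_distrib d_def mult_ac)
      have "vol (rel_cball C x r) \<le> vol (cball x r)"
        using lmeas[of x r] by (intro measure_mono_fmeasurable[OF rel(3)]) (auto simp: fmeasurableD)
      then show "vol (rel_cball C x r) \<le> ?\<omega> * r ^ (n + 1)"
        using vol_cball[of r x] r by (simp add: d_def)
    qed
  qed
qed

end
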